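(* Let $N\ge1$ be an integer, $c>0$ and $b\in(0,1)$. Let $X_c$ be the set of vectors $\tilde x=(\tilde x_1,\dots,\tilde x_N)\in(0,\infty)^N$ with $\tilde x_1\ge\tilde x_2\ge\dots\ge\tilde x_N>0$ and $\sum_{i=1}^N\tilde x_i=c$, and let $g$ be the mapping on $X_c$ defined in the context (the AIMD case $\gamma_k=0$, $b_k=b$ for all $k$). Then $g$ has a unique fixed point $\tilde x^*=(\tilde x_1^*,\dots,\tilde x_N^* )$ in $X_c$, given by $$\tilde x_n^*=\left(b+\frac{(N-n+1)(1-b)}{N}\right)\frac{c}{Nb+\frac{(N+1)(1-b)}{2}},\qquad 1\le n\le N,$$ and, for every $\tilde x\in X_c$, the iterates $\tilde x^{(0)}=\tilde x$, $\tilde x^{(m)}=g(\tilde x^{(m-1)})$, $m\ge1$, satisfy $\tilde x^{(m)}\to\tilde x^*$ as $m\to\infty$.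
   Context: The mapping $g:X_c\to X_c$, $g=(g_1,\dots,g_N)$. Put $b_1=\frac{1-b}{N}$. For $\tilde x\in X_c$ let $k=k(\tilde x)\in\{1,\dots,N\}$ be the integer with $\tilde x_k\ge b\tilde x_1>\tilde x_{k+1}$, with the convention $\tilde x_{N+1}:=0$. Then $$g_i(\tilde x)=\tilde x_{i+1}+b_1\tilde x_1\ (1\le i\le k-1),\qquad g_k(\tilde x)=b\tilde x_1+b_1\tilde x_1,\qquad g_i(\tilde x)=\tilde x_i+b_1\tilde x_1\ (k+1\le i\le N).$$ Interpretation: $N$ users' rates grow linearly with a common slope; whenever the sum of the rates reaches $c$, the largest rate is multiplied by $b$; $g$ maps the decreasingly ordered vector of rates at one such instant (before reduction) to the ordered vector of rates at the next such instant (before reduction). *)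

theory Defs
  imports "HOL-Analysis.Analysis"
begin

text \<open>
  A vector in real \<open>N\<close>-space is a function in \<open>{1..N} \<rightarrow>\<^sub>E UNIV\<close>, that is, a function on
  \<open>nat\<close> with the fixed value \<open>undefined\<close> outside \<open>{1..N}\<close>; so equality of such functions is
  equality of the \<open>N\<close> components.
\<close>

definition rate_set :: "nat \<Rightarrow> real \<Rightarrow> (nat \<Rightarrow> real) set" where
  "rate_set N c = {x \<in> {1..N} \<rightarrow>\<^sub>E {0<..}.
     (\<forall>i\<in>{1..<N}. x (i + 1) \<le> x i) \<and> (\<Sum>i = 1..N. x i) = c}"

text \<open>
  The description below determines a unique index only for ordered positive vectors
  (lemma \<open>cut_index_ex1\<close>); elsewhere \<open>cut_index\<close> is unspecified.  The conditional renders the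
  convention that the component with index \<open>N + 1\<close> is zero.
\<close>

definition is_cut_index :: "nat \<Rightarrow> real \<Rightarrow> (nat \<Rightarrow> real) \<Rightarrow> nat \<Rightarrow> bool" where
  "is_cut_index N b x k \<longleftrightarrow>
     k \<in> {1..N} \<and> x k \<ge> b * x 1 \<and> b * x 1 > (if k = N then 0 else x (k + 1))"

definition cut_index :: "nat \<Rightarrow> real \<Rightarrow> (nat \<Rightarrow> real) \<Rightarrow> nat" where
  "cut_index N b x = (THE k. is_cut_index N b x k)"

definition aimd_map :: "nat \<Rightarrow> real \<Rightarrow> (nat \<Rightarrow> real) \<Rightarrow> nat \<Rightarrow> real" where
  "aimd_map N b x =
     (let k = cut_index N b x; b1 = (1 - b) / real N
      in (\<lambda>i\<in>{1..N}.
            if i < k then x (i + 1) + b1 * x 1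
            else if i = k then b * x 1 + b1 * x 1
            else x i + b1 * x 1))"

lemma rate_set_antimono:
  assumes "x \<in> rate_set N c" "1 \<le> i" "i \<le> j" "j \<le> N"
  shows "x j \<le> x i"
  using assms(3,4)
proof (induction j rule: dec_induct)
  case base
  then show ?case by simp
next
  case (step n)
  have "x (n + 1) \<le> x n"
    using assms(1,2) step by (auto simp: rate_set_def)
  then show ?case using step by simp
qed

lemma cut_index_ex1:
  assumes x: "x \<in> rate_set N c" and N: "N \<ge> 1" and b: "0 < b" "b < 1"
  shows "\<exists>!k. is_cut_index N b x k"
proof -
  have pos: "x i > 0" if "i \<in> {1..N}" for i
    using x that by (auto simp: rate_set_def PiE_def Pi_def)
  define S where "S = {k \<in> {1..N}. x k \<ge> b * x 1}"
  have fin: "finite S" by (simp add: S_def)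
  have "b * x 1 \<le> x 1" using pos[of 1] N b by (simp add: mult_left_le_one_le)
  hence "1 \<in> S" using N by (simp add: S_def)
  hence ne: "S \<noteq> {}" by blast
  have max: "Max S \<in> S" using fin ne by (rule Max_in)
  have "x (Max S + 1) < b * x 1" if "Max S \<noteq> N"
  proof (rule ccontr)
    assume "\<not> ?thesis"
    hence "Max S + 1 \<in> S" using max that by (auto simp: S_def)
    hence "Max S + 1 \<le> Max S" using fin by (simp add: Max_ge)
    thus False by simp
  qed
  hence ex: "is_cut_index N b x (Max S)"
    using max pos[of 1] N b by (auto simp: is_cut_index_def S_def)
  have uniq: "\<not> k < l" if "is_cut_index N b x k" "is_cut_index N b x l" for k l
  proof
    assume "k < l"
    hence "x l \<le> x (k + 1)"
      using that by (intro rate_set_antimono[OF x]) (auto simp: is_cut_index_def)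
    thus False using that \<open>k < l\<close> by (auto simp: is_cut_index_def split: if_splits)
  qed
  show ?thesis using ex uniq by (metis linorder_neqE_nat)
qed

lemma aimd_map_in_rate_set:
  assumes x: "x \<in> rate_set N c" and N: "N \<ge> 1" and b: "0 < b" "b < 1"
  shows "aimd_map N b x \<in> rate_set N c"
proof -
  define k where "k = cut_index N b x"
  define b1 where "b1 = (1 - b) / real N"
  have "is_cut_index N b x k"
    unfolding k_def cut_index_def by (rule theI'[OF cut_index_ex1[OF assms]])
  hence k: "1 \<le> k" "k \<le> N" "x k \<ge> b * x 1" "k \<noteq> N \<Longrightarrow> x (k + 1) < b * x 1"
    by (auto simp: is_cut_index_def)
  have pos: "x i > 0" if "i \<in> {1..N}" for i
    using x that by (auto simp: rate_set_def PiE_def Pi_def)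
  have b1: "b1 > 0" using b N by (simp add: b1_def)
  define h where "h i = (if i < k then x (i + 1) else if i = k then b * x 1 else x i)" for i
  have eq: "aimd_map N b x = (\<lambda>i\<in>{1..N}. h i + b1 * x 1)"
    by (auto simp: aimd_map_def Let_def k_def b1_def h_def)
  have x1: "x 1 > 0" using pos N by simp
  have hpos: "h i > 0" if "i \<in> {1..N}" for i
    using that k x1 b pos by (auto simp: h_def)
  have mono: "h (i + 1) \<le> h i" if i: "i \<in> {1..<N}" for i
  proof -
    consider "i + 1 < k" | "i + 1 = k" | "i = k" | "i > k" by linarith
    thus ?thesis
    proof cases
      case 1
      have "x (i + 2) \<le> x (i + 1)" using 1 k by (intro rate_set_antimono[OF x]) auto
      thus ?thesis using 1 by (simp add: h_def)
    next
      case 2 thus ?thesis using k by (auto simp: h_def)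
    next
      case 3 thus ?thesis using k i by (auto simp: h_def)
    next
      case 4
      have "x (i + 1) \<le> x i" using i by (intro rate_set_antimono[OF x]) auto
      thus ?thesis using 4 by (simp add: h_def)
    qed
  qed
  have split: "{1..N} = {1..<k} \<union> {k} \<union> {k<..N}" using k by auto
  have sumsplit: "sum f {1..N} = sum f {1..<k} + f k + sum f {k<..N}" for f :: "nat \<Rightarrow> real"
    unfolding split by (subst sum.union_disjoint; auto)+
  have "sum h {1..N} = (\<Sum>i\<in>{1..<k}. x (i + 1)) + b * x 1 + sum x {k<..N}"
    unfolding sumsplit by (simp add: h_def)
  also have "(\<Sum>i\<in>{1..<k}. x (i + 1)) = sum x {1<..k}"
    by (rule sum.reindex_bij_witness[of _ "\<lambda>i. i - 1" "\<lambda>i. i + 1"]) auto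
  also have "sum x {1<..k} = sum x {1..k} - x 1"
    using k by (simp add: sum.head)
  also have "sum x {1..k} = sum x {1..<k} + x k"
    using k by (metis sum.last_plus add.commute)
  finally have "sum h {1..N} = sum x {1..N} - (1 - b) * x 1"
    using sumsplit[of x] by (simp add: algebra_simps)
  hence "(\<Sum>i = 1..N. h i + b1 * x 1) = sum x {1..N}"
    using N by (simp add: sum.distrib b1_def)
  also have "\<dots> = c" using x by (simp add: rate_set_def)
  finally have sum: "(\<Sum>i = 1..N. h i + b1 * x 1) = c" .
  show ?thesis
    unfolding eq rate_set_def using hpos mono sum b1 x1 by (auto intro: add_pos_pos)
qed

end

theory Submission imports Defs begin

text \<open>
  If \<open>z\<close> satisfies \<open>b z\<^sub>1 \<le> z\<^sub>N\<close>, then \<open>z \<le> x\<close> implies \<open>L z \<le> g x\<close>, where \<open>L\<close> is the linear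
  map describing \<open>g\<close> at cut index \<open>N\<close>.  The vector \<open>x\<^sup>*\<close> is a positive fixed point of \<open>L\<close>, so a
  bound \<open>\<lambda> x\<^sup>* \<le> x\<close> persists under \<open>g\<close>.  As both vectors have sum \<open>c\<close>, some coordinate of
  \<open>x - \<lambda> x\<^sup>*\<close> is at least \<open>(1 - \<lambda>) c / N\<close>; the map \<open>L\<close> moves this excess to the first
  coordinate and then spreads it over all coordinates, so that \<open>N\<close> iterations decrease
  \<open>1 - \<lambda>\<close> by a constant factor.  Once \<open>\<lambda> \<rightarrow> 1\<close>, the equality of sums forces \<open>x \<rightarrow> x\<^sup>*\<close>.
\<close>

section \<open>A linear lower bound for one application of the map\<close>

lemma aimd_map_lower_bound:
  assumes x: "x \<in> rate_set N c" and N: "N \<ge> 1" and b: "0 < b" "b < 1"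
    and le: "\<And>j. j \<in> {1..N} \<Longrightarrow> z j \<le> x j" and cut: "b * z 1 \<le> z N"
    and i: "i \<in> {1..N}"
  shows "(if i = N then b * z 1 else z (i + 1)) + (1 - b) / N * z 1 \<le> aimd_map N b x i"
proof -
  define k where "k = cut_index N b x"
  have "is_cut_index N b x k"
    unfolding k_def cut_index_def by (rule theI'[OF cut_index_ex1[OF x N b]])
  hence k: "1 \<le> k" "k \<le> N" "k \<noteq> N \<Longrightarrow> x (k + 1) < b * x 1"
    by (auto simp: is_cut_index_def)
  have bz: "b * z 1 \<le> b * x 1" using le[of 1] N b by simp
  have b1: "(1 - b) / N * z 1 \<le> (1 - b) / N * x 1"
    using le[of 1] N b by (intro mult_left_mono) auto
  \<comment> \<open>For \<open>i < N\<close> the shifted coordinate \<open>x (i + 1)\<close> is a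
    lower bound in all three branches: at \<open>i = k\<close> because
    \<open>x (k + 1) < b * x 1\<close>, and for \<open>i > k\<close> by monotonicity. For
    \<open>i = N\<close> and \<open>k < N\<close> the value is \<open>x N\<close>, and
    \<open>cut\<close> applies.\<close>
  have "(if i = N then b * z 1 else z (i + 1))
      \<le> (if i < k then x (i + 1) else if i = k then b * x 1 else x i)"
  proof (cases "i = N")
    case True
    then show ?thesis using k bz cut le[of N] N by auto
  next
    case False
    hence "z (i + 1) \<le> x (i + 1)" "x (i + 1) \<le> x i"
      using i by (auto intro: le rate_set_antimono[OF x])
    then show ?thesis using False k by auto
  qed
  with b1 show ?thesis
    using i by (auto simp: aimd_map_def Let_def k_def split: if_splits)
qed

section \<open>The explicit fixed point\<close>

locale aimd =
  fixes N :: nat and b c :: real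
  assumes N: "N \<ge> 1" and c: "c > 0" and b: "0 < b" "b < 1"
begin

definition b1 :: real where "b1 = (1 - b) / N"

text \<open>The factor that makes the coordinates sum to \<open>c\<close>. It is also the first,
  hence largest, coordinate, since \<open>b + N * b1 = 1\<close>.\<close>

definition scale :: real where "scale = c / (N * b + (real N + 1) * (1 - b) / 2)"

definition fixpoint :: "nat \<Rightarrow> real" where
  "fixpoint = (\<lambda>n\<in>{1..N}. (b + (real N - real n + 1) * b1) * scale)"

lemma b1: "0 < b1" "b1 < 1" "N * b1 = 1 - b"
proof -
  show "0 < b1" "N * b1 = 1 - b" using N b by (auto simp: b1_def)
  have "1 - b < real N" using N b by simp
  thus "b1 < 1" using N by (simp add: b1_def)
qed

lemma scale_pos: "scale > 0"
  using N b c by (auto simp: scale_def intro!: divide_pos_pos add_pos_pos mult_pos_pos)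

lemma fixpoint_1: "fixpoint (Suc 0) = scale"
  using N b1(3) by (simp add: fixpoint_def)

lemma fixpoint_N: "fixpoint N = (b + b1) * scale"
  using N by (simp add: fixpoint_def)

text \<open>The coordinates form an arithmetic progression. Together with \<open>fixpoint_1\<close>
  and \<open>fixpoint_N\<close> this says that the linear map at cut index \<open>N\<close> fixes
  \<open>fixpoint\<close>.\<close>

lemma fixpoint_Suc: "i \<in> {1..<N} \<Longrightarrow> fixpoint (i + 1) + b1 * scale = fixpoint i"
  by (auto simp: fixpoint_def algebra_simps)

lemma fixpoint_pos: "i \<in> {1..N} \<Longrightarrow> 0 < fixpoint i"
  using scale_pos b b1(1) by (auto simp: fixpoint_def intro!: mult_pos_pos add_pos_nonneg)

lemma fixpoint_le:
  assumes "i \<in> {1..N}" shows "fixpoint i \<le> scale"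
proof -
  have "(real N - real i + 1) * b1 \<le> N * b1"
    using assms b1(1) by (intro mult_right_mono) auto
  hence "b + (real N - real i + 1) * b1 \<le> 1" using b1(3) by linarith
  thus ?thesis using assms scale_pos by (simp add: fixpoint_def mult_le_cancel_right1)
qed

lemma sum_fixpoint: "(\<Sum>i = 1..N. fixpoint i) = c"
proof -
  \<comment> \<open>The induction is over a length \<open>n\<close> independent of \<open>N\<close>,
    with \<open>b1\<close> held fixed, because \<open>b1\<close> itself depends on \<open>N\<close>.
    The factor \<open>n * b1\<close> is left intact so that it becomes \<open>1 - b\<close> at
    \<open>n = N\<close>.\<close>
  have *: "(\<Sum>i = 1..n. b + (real n - real i + 1) * b1) = n * b + (real n + 1) * (n * b1) / 2"
    for n
  proof (induction n)
    case (Suc n)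
    have "(\<Sum>i = 1..Suc n. b + (real (Suc n) - real i + 1) * b1)
        = (\<Sum>i = 1..n. b + (real n - real i + 1) * b1 + b1) + b + b1"
      by (simp add: algebra_simps)
    also have "\<dots> = n * b + (real n + 1) * (n * b1) / 2 + n * b1 + b + b1"
      by (subst sum.distrib) (simp only: Suc.IH, simp)
    finally show ?case by (simp add: field_simps)
  qed simp
  have pos: "N * b + (real N + 1) * (1 - b) / 2 > 0"
    using N b by (intro add_pos_pos) auto
  have "(\<Sum>i = 1..N. fixpoint i) = (\<Sum>i = 1..N. b + (real N - real i + 1) * b1) * scale"
    by (simp add: fixpoint_def sum_distrib_right)
  also have "\<dots> = (N * b + (real N + 1) * (1 - b) / 2) * scale"
    by (simp only: * b1(3))
  also have "\<dots> = c" using pos by (simp add: scale_def)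
  finally show ?thesis .
qed

lemma fixpoint_in_rate_set: "fixpoint \<in> rate_set N c"
proof -
  have "fixpoint (i + 1) \<le> fixpoint i" if "i \<in> {1..<N}" for i
    using fixpoint_Suc[OF that] mult_pos_pos[OF b1(1) scale_pos] by linarith
  moreover have "fixpoint \<in> extensional {1..N}" by (simp add: fixpoint_def)
  ultimately show ?thesis
    using fixpoint_pos sum_fixpoint by (auto simp: rate_set_def PiE_iff)
qed

lemma iterate_in_rate_set: "x \<in> rate_set N c \<Longrightarrow> (aimd_map N b ^^ m) x \<in> rate_set N c"
  by (induction m) (auto intro: aimd_map_in_rate_set N b)

section \<open>Lower bounds by multiples of the fixed point\<close>

definition dominates :: "(nat \<Rightarrow> real) \<Rightarrow> real \<Rightarrow> bool" where
  "dominates x l \<longleftrightarrow> (\<forall>i\<in>{1..N}. l * fixpoint i \<le> x i)"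

lemma sum_excess:
  "x \<in> rate_set N c \<Longrightarrow> (\<Sum>i = 1..N. x i - l * fixpoint i) = (1 - l) * c"
  unfolding sum_subtractf sum_distrib_left[symmetric] sum_fixpoint
  by (simp add: rate_set_def algebra_simps)

text \<open>The excesses over \<open>l * fixpoint\<close> are nonnegative with sum
  \<open>(1 - l) * c\<close>, both for \<open>x\<close> and for \<open>fixpoint\<close>. Hence at
  each coordinate both excesses lie between 0 and \<open>(1 - l) * c\<close>, and so does the
  absolute value of their difference.\<close>

lemma dist_fixpoint_le:
  assumes x: "x \<in> rate_set N c" and dom: "dominates x l" and l: "l \<le> 1" and i: "i \<in> {1..N}"
  shows "\<bar>x i - fixpoint i\<bar> \<le> (1 - l) * c"
proof -
  have "x i - l * fixpoint i \<le> (\<Sum>j = 1..N. x j - l * fixpoint j)"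
    using dom i by (intro member_le_sum) (auto simp: dominates_def)
  also have "\<dots> = (1 - l) * c" by (rule sum_excess[OF x])
  finally have 1: "x i - l * fixpoint i \<le> (1 - l) * c" .
  have nonneg: "l * fixpoint j \<le> fixpoint j" if "j \<in> {1..N}" for j
    using l fixpoint_pos[OF that] by (simp add: mult_le_cancel_right1)
  have "fixpoint i - l * fixpoint i \<le> (\<Sum>j = 1..N. fixpoint j - l * fixpoint j)"
    using i nonneg by (intro member_le_sum) auto
  also have "\<dots> = (1 - l) * c" by (rule sum_excess[OF fixpoint_in_rate_set])
  finally have 2: "fixpoint i - l * fixpoint i \<le> (1 - l) * c" .
  show ?thesis using 1 2 nonneg[OF i] dom i by (force simp: dominates_def)
qed

lemma dominates_1:
  assumes x: "x \<in> rate_set N c" and dom: "dominates x 1"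
  shows "x = fixpoint"
proof (rule extensionalityI)
  show "x \<in> extensional {1..N}" using x by (simp add: rate_set_def PiE_iff)
  show "fixpoint \<in> extensional {1..N}" by (simp add: fixpoint_def)
  show "x i = fixpoint i" if "i \<in> {1..N}" for i
    using dist_fixpoint_le[OF x dom _ that] by simp
qed

lemma dominates_le_1:
  assumes x: "x \<in> rate_set N c" and dom: "dominates x l"
  shows "l \<le> 1"
proof -
  have "0 \<le> (\<Sum>i = 1..N. x i - l * fixpoint i)"
    using dom by (intro sum_nonneg) (auto simp: dominates_def)
  hence "0 \<le> (1 - l) * c" by (simp only: sum_excess[OF x])
  thus ?thesis using c by (simp add: zero_le_mult_iff)
qed

text \<open>
  The case \<open>d = 0\<close> is the invariance of \<open>dominates\<close>.  The bound on \<open>d\<close> is what keeps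
  \<open>b z\<^sub>1 \<le> z\<^sub>N\<close> for \<open>z = l x\<^sup>* + d e\<^sub>1\<close>.
\<close>

lemma aimd_map_excess:
  assumes x: "x \<in> rate_set N c" and d: "0 \<le> d" "d \<le> l * b1 * scale"
    and le: "\<And>j. j \<in> {1..N} \<Longrightarrow> l * fixpoint j + (if j = p then d else 0) \<le> x j"
    and i: "i \<in> {1..N}"
  shows "l * fixpoint i + (if p = 1 then b1 * d else if i + 1 = p \<and> p \<le> N then d else 0)
    \<le> aimd_map N b x i"
proof -
  define z where "z j = l * fixpoint j + (if j = p then d else 0)" for j
  have "b * d \<le> d" using b d by (simp add: mult_left_le_one_le)
  hence "b * d \<le> l * b1 * scale" using d by linarith
  hence cut: "b * z 1 \<le> z N"
  proof -
    have "b * z 1 = b * (l * scale) + (if p = 1 then b * d else 0)"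
      by (simp add: z_def fixpoint_1 distrib_left)
    moreover have "z N = b * (l * scale) + l * b1 * scale + (if p = N then d else 0)"
      by (auto simp: z_def fixpoint_N algebra_simps)
    moreover have "0 \<le> l * b1 * scale" using d by linarith
    ultimately show ?thesis using \<open>b * d \<le> l * b1 * scale\<close> d(1) by auto
  qed
  have "(if i = N then b * z 1 else z (i + 1)) + b1 * z 1 \<le> aimd_map N b x i"
    unfolding b1_def
    using aimd_map_lower_bound[OF x N b _ cut i] le by (simp add: z_def)
  \<comment> \<open>The linear map fixes the part \<open>l * fixpoint\<close>. An excess
    \<open>d\<close> at \<open>p > 1\<close> moves to \<open>p - 1\<close>; at \<open>p = 1\<close>
    it gives \<open>b1 * d\<close> everywhere, and the further \<open>b * d\<close> at coordinate
    \<open>N\<close> is dropped.\<close>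
  moreover have "l * fixpoint i + (if p = 1 then b1 * d else if i + 1 = p \<and> p \<le> N then d else 0)
      \<le> (if i = N then b * z 1 else z (i + 1)) + b1 * z 1"
  proof (cases "i = N")
    case True
    have "l * fixpoint N = b * (l * scale) + b1 * (l * scale)"
      by (simp add: fixpoint_N algebra_simps)
    moreover have "0 \<le> b * d" using b d by simp
    ultimately show ?thesis using True d by (auto simp: z_def fixpoint_1 distrib_left)
  next
    case False
    hence "fixpoint i = fixpoint (i + 1) + b1 * scale" using fixpoint_Suc[of i] i by simp
    hence "l * fixpoint i = l * fixpoint (i + 1) + b1 * (l * scale)"
      by (simp only: distrib_left mult.left_commute)
    thus ?thesis using False d by (auto simp: z_def fixpoint_1 distrib_left)
  qed
  ultimately show ?thesis by linarith
qed

lemma aimd_map_dominates: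
  assumes "x \<in> rate_set N c" "dominates x l" "0 \<le> l"
  shows "dominates (aimd_map N b x) l"
  unfolding dominates_def
proof
  fix i assume "i \<in> {1..N}"
  from aimd_map_excess[OF assms(1) _ _ _ this, of 0 l 0] assms b1(1) scale_pos
  show "l * fixpoint i \<le> aimd_map N b x i" by (auto simp: dominates_def)
qed

lemma iterate_dominates:
  assumes "x \<in> rate_set N c" "dominates x l" "0 \<le> l"
  shows "dominates ((aimd_map N b ^^ m) x) l"
  using assms by (induction m) (auto intro: aimd_map_dominates iterate_in_rate_set)

text \<open>The image dominates \<open>fixpoint\<close> and has the same sum, so it equals
  \<open>fixpoint\<close>; this avoids computing its cut index.\<close>

lemma aimd_map_fixpoint: "aimd_map N b fixpoint = fixpoint"
  using fixpoint_in_rate_set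
  by (intro dominates_1 aimd_map_in_rate_set aimd_map_dominates N b) (auto simp: dominates_def)

section \<open>Contraction over \<open>N\<close> iterations\<close>

text \<open>After \<open>p\<close> shifts the excess sits at coordinate 1, and one more step spreads
  it. As \<open>fixpoint i \<le> scale\<close>, a uniform excess \<open>b1 * d\<close> raises the
  multiple \<open>l\<close> by \<open>b1 * d / scale\<close>.\<close>

lemma iterate_spread:
  assumes "x \<in> rate_set N c" and d: "0 \<le> d" "d \<le> l * b1 * scale"
    and "p < N"
    and "\<And>j. j \<in> {1..N} \<Longrightarrow> l * fixpoint j + (if j = Suc p then d else 0) \<le> x j"
  shows "dominates ((aimd_map N b ^^ Suc p) x) (l + b1 * d / scale)"
  using assms(1,4,5)
proof (induction p arbitrary: x)
  case 0
  have "(l + b1 * d / scale) * fixpoint i \<le> aimd_map N b x i" if i: "i \<in> {1..N}" for i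
  proof -
    have "l * fixpoint i + b1 * d \<le> aimd_map N b x i"
      using aimd_map_excess[OF 0(1) d 0(3) i] by simp
    moreover have "b1 * d / scale * fixpoint i \<le> b1 * d / scale * scale"
      using fixpoint_le[OF i] b1(1) d scale_pos by (intro mult_left_mono) auto
    ultimately show ?thesis using scale_pos by (simp add: distrib_right)
  qed
  thus ?case by (simp add: dominates_def)
next
  case (Suc p)
  have "l * fixpoint j + (if j = Suc p then d else 0) \<le> aimd_map N b x j"
    if j: "j \<in> {1..N}" for j
    using aimd_map_excess[OF Suc.prems(1) d Suc.prems(3) j] Suc.prems(2) by simp
  with Suc.prems Suc.IH[of "aimd_map N b x"] show ?case
    by (simp add: funpow_swap1 aimd_map_in_rate_set N b)
qed

lemma contraction:
  assumes x: "x \<in> rate_set N c" and dom: "dominates x l" and l0: "0 < l0" "l0 \<le> l"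
    and t: "t = b1 * min (l0 * b1 * scale) (c / N) / scale"
  shows "dominates ((aimd_map N b ^^ N) x) (1 - (1 - t) * (1 - l))"
proof -
  \<comment> \<open>The first entry of the minimum makes \<open>d\<close> small enough for
    \<open>iterate_spread\<close>; the second keeps \<open>d\<close> at most the average excess
    \<open>(1 - l) * c / N\<close>, so that some coordinate attains it. Using \<open>l0\<close>
    instead of \<open>l\<close> makes \<open>t\<close> the same in every block of
    iterations.\<close>
  define h where "h = min (l0 * b1 * scale) (c / N)"
  define d where "d = h * (1 - l)"
  have l1: "l \<le> 1" by (rule dominates_le_1[OF x dom])
  have h: "0 \<le> h" "h \<le> l0 * b1 * scale" "h \<le> c / N"
    using l0 b1(1) scale_pos c by (auto simp: h_def)
  have d0: "0 \<le> d" using h l1 by (simp add: d_def)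
  have "d \<le> h" using h l1 l0 by (simp add: d_def mult_left_le)
  also note h(2)
  also have "l0 * b1 * scale \<le> l * b1 * scale"
    using l0 b1(1) scale_pos by (intro mult_right_mono) auto
  finally have d1: "d \<le> l * b1 * scale" .
  obtain p where p: "p \<in> {1..N}" "d \<le> x p - l * fixpoint p"
  proof (rule ccontr)
    assume "\<not> thesis"
    hence "\<And>j. j \<in> {1..N} \<Longrightarrow> x j - l * fixpoint j < d" using that by force
    hence "(\<Sum>j = 1..N. x j - l * fixpoint j) < (\<Sum>j = 1..N. d)"
      using N by (intro sum_strict_mono) auto
    also have "\<dots> = N * (h * (1 - l))" by (simp add: d_def)
    also have "\<dots> \<le> N * (c / N * (1 - l))"
      using h(3) l1 by (intro mult_left_mono mult_right_mono) auto
    also have "\<dots> = (1 - l) * c" using N by simp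
    also have "(\<Sum>j = 1..N. x j - l * fixpoint j) = (1 - l) * c"
      by (rule sum_excess[OF x])
    finally show False by simp
  qed
  have "dominates ((aimd_map N b ^^ Suc (p - 1)) x) (l + b1 * d / scale)"
    using p dom by (intro iterate_spread x d0 d1) (auto simp: dominates_def)
  moreover have "Suc (p - 1) = p" using p by simp
  ultimately have "dominates ((aimd_map N b ^^ p) x) (l + b1 * d / scale)" by (simp only:)
  \<comment> \<open>The position \<open>p\<close> depends on \<open>x\<close>; padding with
    \<open>N - p\<close> iterations, which preserve the bound, gives a uniform block length.\<close>
  hence "dominates ((aimd_map N b ^^ (N - p)) ((aimd_map N b ^^ p) x)) (l + b1 * d / scale)"
    using p l0 b1(1) d0 scale_pos by (intro iterate_dominates[OF iterate_in_rate_set[OF x]]) auto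
  moreover have "l + b1 * d / scale = 1 - (1 - t) * (1 - l)"
    unfolding t h_def[symmetric] by (simp add: d_def field_simps)
  ultimately show ?thesis
    using p by (simp flip: funpow_add comp_apply[of "_ ^^ _" "_ ^^ _"])
qed

section \<open>Convergence and uniqueness\<close>

lemma iterate_tendsto:
  assumes x: "x \<in> rate_set N c" and i: "i \<in> {1..N}"
  shows "(\<lambda>m. (aimd_map N b ^^ m) x i) \<longlonglongrightarrow> fixpoint i"
proof -
  \<comment> \<open>The smallest coordinate of \<open>x\<close> over the largest coordinate of
    \<open>fixpoint\<close>: a positive multiple that \<open>x\<close> dominates.\<close>
  define l0 where "l0 = x N / scale"
  define t where "t = b1 * min (l0 * b1 * scale) (c / N) / scale"
  \<comment> \<open>The solution of \<open>1 - r (Suc m) = (1 - t) * (1 - r m)\<close> with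
    \<open>r 0 = l0\<close>.\<close>
  define r where "r m = 1 - (1 - t) ^ m * (1 - l0)" for m
  have xN: "x N > 0" using x N by (auto simp: rate_set_def PiE_iff)
  hence l0: "0 < l0" using scale_pos by (simp add: l0_def)
  have "l0 * fixpoint j \<le> x j" if j: "j \<in> {1..N}" for j
  proof -
    have "l0 * fixpoint j \<le> l0 * scale" using fixpoint_le[OF j] l0 by simp
    also have "\<dots> = x N" using scale_pos by (simp add: l0_def)
    also have "\<dots> \<le> x j" using j by (intro rate_set_antimono[OF x]) auto
    finally show ?thesis .
  qed
  hence dom0: "dominates x l0" by (simp add: dominates_def)
  have l1: "l0 \<le> 1" by (rule dominates_le_1[OF x dom0])
  have t0: "0 < t" using b1(1) l0 c N scale_pos by (simp add: t_def)
  have "t \<le> b1 * (l0 * b1 * scale) / scale"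
    unfolding t_def using b1(1) scale_pos by (intro divide_right_mono mult_left_mono) auto
  also have "\<dots> = b1 * b1 * l0" using scale_pos by simp
  also have "\<dots> \<le> 1" using b1 l0 l1 by (intro mult_le_one) auto
  finally have t1: "t \<le> 1" .
  have r: "l0 \<le> r m" "r m \<le> 1" for m
  proof -
    have "0 \<le> (1 - t) ^ m" "(1 - t) ^ m \<le> 1" using t0 t1 by (auto intro: power_le_one)
    thus "l0 \<le> r m" "r m \<le> 1" using l1 mult_right_mono[of "(1 - t) ^ m" 1 "1 - l0"]
      by (auto simp: r_def)
  qed
  have multiples: "dominates ((aimd_map N b ^^ (N * m)) x) (r m)" for m
  proof (induction m)
    case 0
    show ?case using dom0 by (simp add: r_def)
  next
    case (Suc m)
    from contraction[OF iterate_in_rate_set[OF x] Suc l0 r(1) t_def]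
    show ?case by (simp add: funpow_add r_def mult.assoc)
  qed
  \<comment> \<open>The \<open>m mod N\<close> iterations after the last full block keep its
    bound.\<close>
  have "dominates ((aimd_map N b ^^ m) x) (r (m div N))" for m
  proof -
    have "dominates ((aimd_map N b ^^ (m mod N)) ((aimd_map N b ^^ (N * (m div N))) x)) (r (m div N))"
      using multiples r(1)[of "m div N"] l0
      by (intro iterate_dominates[OF iterate_in_rate_set[OF x]]) auto
    thus ?thesis by (simp flip: funpow_add comp_apply[of "_ ^^ _" "_ ^^ _"])
  qed
  hence bound: "\<bar>(aimd_map N b ^^ m) x i - fixpoint i\<bar> \<le> (1 - r (m div N)) * c" for m
    by (intro dist_fixpoint_le iterate_in_rate_set x r i)
  have "filterlim (\<lambda>m. m div N) sequentially sequentially"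
    unfolding filterlim_at_top
  proof
    fix K
    show "\<forall>\<^sub>F m in sequentially. K \<le> m div N"
      using eventually_ge_at_top[of "K * N"]
      by eventually_elim (use N in \<open>simp add: less_eq_div_iff_mult_less_eq\<close>)
  qed
  moreover have "(\<lambda>m. (1 - r m) * c) \<longlonglongrightarrow> 0"
    unfolding r_def using t0 t1 by (auto intro!: tendsto_eq_intros LIMSEQ_power_zero)
  ultimately have "(\<lambda>m. (1 - r (m div N)) * c) \<longlonglongrightarrow> 0"
    by (rule filterlim_compose[rotated])
  hence "(\<lambda>m. (aimd_map N b ^^ m) x i - fixpoint i) \<longlonglongrightarrow> 0"
    by (rule Lim_null_comparison[rotated]) (use bound in simp)
  thus ?thesis by (simp add: LIM_zero_iff)
qed

text \<open>The orbit of a fixed point is constant, and it converges to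
  \<open>fixpoint\<close>.\<close>

lemma fixpoint_unique:
  assumes y: "y \<in> rate_set N c" and fixed: "aimd_map N b y = y"
  shows "y = fixpoint"
proof (rule extensionalityI)
  show "y \<in> extensional {1..N}" using y by (simp add: rate_set_def PiE_iff)
  show "fixpoint \<in> extensional {1..N}" by (simp add: fixpoint_def)
  have "(aimd_map N b ^^ m) y = y" for m by (induction m) (auto simp: fixed)
  thus "y i = fixpoint i" if "i \<in> {1..N}" for i
    using iterate_tendsto[OF y that] by (simp add: LIMSEQ_const_iff)
qed

text \<open>Convergence in the product topology is coordinatewise convergence, provided that the
  iterates and the limit are extensional.\<close>

lemma iterate_limitin:
  assumes x: "x \<in> rate_set N c"
  shows "limitin (powertop_real {1..N}) (\<lambda>m. (aimd_map N b ^^ m) x) fixpoint sequentially"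
proof -
  have "(aimd_map N b ^^ m) x \<in> extensional {1..N}" for m
    using iterate_in_rate_set[OF x, of m] by (simp add: rate_set_def PiE_iff)
  thus ?thesis
    using iterate_tendsto[OF x]
    by (simp add: limitin_componentwise fixpoint_def PiE_iff)
qed

end

theorem theorem2:
  fixes N :: nat and b c :: real
  assumes "N \<ge> 1" and "c > 0" and "0 < b" and "b < 1"
  shows "\<exists>xs. xs \<in> rate_set N c \<and> aimd_map N b xs = xs
           \<and> (\<forall>y \<in> rate_set N c. aimd_map N b y = y \<longrightarrow> y = xs)
           \<and> (\<forall>n \<in> {1..N}. xs n =
                (b + (real N - real n + 1) * (1 - b) / real N)
                  * (c / (real N * b + (real N + 1) * (1 - b) / 2)))
           \<and> (\<forall>x \<in> rate_set N c.
                limitin (powertop_real {1..N}) (\<lambda>m. (aimd_map N b ^^ m) x) xs sequentially)"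
proof -
  interpret aimd N b c using assms by unfold_locales
  have "\<forall>n\<in>{1..N}. fixpoint n = (b + (real N - real n + 1) * (1 - b) / real N)
      * (c / (real N * b + (real N + 1) * (1 - b) / 2))"
    by (simp add: fixpoint_def b1_def scale_def)
  thus ?thesis
    using fixpoint_in_rate_set aimd_map_fixpoint fixpoint_unique iterate_limitin by blast
qed

end
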